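(* Let $F:\mathbb{N}_0\to\mathbb{N}$ be a function, let $b\geq 2$ be an integer, and let $k$ be a fixed positive integer. Set $$s_k=\max\{F(0),F(1),F(2),\ldots,F(b^k-1)\},$$ i.e. the maximum of $F$ over all integers whose base-$b$ representation has at most $k$ digits (the largest being the $k$-digit number $\overline{(b-1)\cdots(b-1)}$). Consider the equation, in the unknowns $m\in\mathbb{N}$ (arbitrary positive integer) and integers $a_0,\dots,a_{km-1}$ with $0\le a_i\le b-1$ and $a_{km-1}\neq 0$, $$\sum_{i=0}^{km-1}a_ib^i=\sum_{i=0}^{m-1}F\big(\overline{a_{ki+k-1}\cdots a_{ki+1}a_{ki}}\big),$$ where $\overline{a_{ki+k-1}\cdots a_{ki}}=\sum_{j=0}^{k-1}a_{ki+j}b^j$. Then: (H) this equation has finitely many solutions. Moreover, every solution $n=\sum_{i=0}^{km-1}a_ib^i$ satisfies $n\leq b^{kM-1}$, where $M$ is given as follows: (1) if $k=1$ and $b=2$, then $M=\max\{7,s_1\}$; (2) if $k=1$ and $b=3$, then $M=\max\{4,s_1\}$; (3) if $k=1$ and $b=4$, then $M=\max\{3,s_1\}$; (4) if $k$ is arbitrary and $b\geq 5$, then $M=\max\{2,s_k\}$.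
   Context: $\mathbb{N}_0$ denotes the non-negative integers and $\mathbb{N}$ the positive integers. A natural number $n$ satisfying the displayed equation is called a base $b$ $k$-grouped $F$-Hardy's apology number: its base-$b$ digits are grouped into $m$ consecutive blocks of $k$ digits, and $n$ equals the sum of $F$ applied to the numbers formed by these blocks. The paper phrases the "moreover" part as: an algorithm finding all solutions only needs to check $n\le b^{kM-1}$. *)

theory Defs
  imports Main
begin

text \<open>Digits are listed least significant first, so \<open>a ! i\<close> is the coefficient of \<open>b ^ i\<close>.\<close>

definition digits_value :: "nat \<Rightarrow> nat list \<Rightarrow> nat" where
  "digits_value b a = (\<Sum>i<length a. a ! i * b ^ i)"

definition block_value :: "nat \<Rightarrow> nat \<Rightarrow> nat list \<Rightarrow> nat \<Rightarrow> nat" where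
  "block_value b k a i = (\<Sum>j<k. a ! (k * i + j) * b ^ j)"

text \<open>
  The unknowns are the number \<open>m\<close> of blocks and the \<open>k * m\<close> digits. Only the leading digit
  \<open>a ! (k * m - 1)\<close> must be nonzero; leading zeros inside the other blocks are allowed.
\<close>

definition apology_solution ::
  "(nat \<Rightarrow> nat) \<Rightarrow> nat \<Rightarrow> nat \<Rightarrow> nat \<Rightarrow> nat list \<Rightarrow> bool" where
  "apology_solution F b k m a \<longleftrightarrow>
     1 \<le> m \<and> length a = k * m \<and> (\<forall>i < k * m. a ! i \<le> b - 1) \<and> a ! (k * m - 1) \<noteq> 0 \<and>
     digits_value b a = (\<Sum>i<m. F (block_value b k a i))"

definition block_max :: "(nat \<Rightarrow> nat) \<Rightarrow> nat \<Rightarrow> nat \<Rightarrow> nat" where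
  "block_max F b k = Max (F ` {0..b ^ k - 1})"

end

theory Submission
  imports Defs
begin

text \<open>
  A solution with \<open>m\<close> blocks satisfies \<open>b ^ (k * m - 1) \<le> n \<le> m * s\<close>, where \<open>s\<close> is the block
  maximum. If \<open>m \<ge> s\<close>, this gives \<open>b ^ (m - 1) \<le> m\<^sup>2\<close>, which fails for \<open>m \<ge> 7, 4, 3, 2\<close> when
  \<open>b = 2\<close>, \<open>b = 3\<close>, \<open>b = 4\<close>, \<open>b \<ge> 5\<close>, respectively. Hence \<open>m < M\<close>, and
  \<open>n < b ^ (k * m) \<le> b ^ (k * M - 1)\<close>.
\<close>

text \<open>Stated for a digit function instead of a list, so that it serves both a whole number and
  a single block at an offset.\<close>

lemma sum_digits_less_power:
  fixes f :: "nat \<Rightarrow> nat"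
  assumes "1 \<le> b" and "\<And>i. i < n \<Longrightarrow> f i \<le> b - 1"
  shows "(\<Sum>i<n. f i * b ^ i) < b ^ n"
  using assms(2)
proof (induction n)
  case 0
  then show ?case by simp
next
  case (Suc n)
  have "(\<Sum>i<n. f i * b ^ i) < b ^ n" using Suc by simp
  moreover have "f n * b ^ n \<le> (b - 1) * b ^ n"
    using Suc.prems by (intro mult_le_mono1) simp
  ultimately have "(\<Sum>i<Suc n. f i * b ^ i) < b ^ n + (b - 1) * b ^ n"
    by (simp only: sum.lessThan_Suc add_less_le_mono)
  also have "\<dots> = b ^ Suc n" using assms(1) by (cases b) simp_all
  finally show ?case .
qed

text \<open>Induction upwards from \<open>c\<close>: passing from \<open>m\<close> to
  \<open>m + 1\<close> multiplies the right side by \<open>b\<close>, so it suffices that the square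
  grows by a factor of at most \<open>b\<close>. The last hypothesis guarantees this; the base case
  is left to a numerical check.\<close>

lemma square_less_power_pred:
  fixes b c m :: nat
  assumes "c\<^sup>2 < b ^ (c - 1)" and "c \<le> m" and "1 \<le> c" and "3 \<le> c \<and> 2 \<le> b \<or> 4 \<le> b"
  shows "m\<^sup>2 < b ^ (m - 1)"
  using assms(2)
proof (induction m rule: dec_induct)
  case base
  show ?case by (rule assms(1))
next
  case (step m)
  have "(Suc m)\<^sup>2 \<le> b * m\<^sup>2"
    using assms(4)
  proof
    assume b: "3 \<le> c \<and> 2 \<le> b"
    \<comment> \<open>Since \<open>1 \<le> m\<close>, this gives
      \<open>2 * m + 1 \<le> 3 * m \<le> m * m\<close>.\<close>
    with step have "3 * m \<le> m * m" by simp
    moreover have "1 \<le> m" using b step by simp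
    moreover have "(Suc m)\<^sup>2 = m * m + 2 * m + 1" "2 * m\<^sup>2 = m * m + m * m"
      by (simp_all add: power2_eq_square)
    ultimately have "(Suc m)\<^sup>2 \<le> 2 * m\<^sup>2" by linarith
    also have "\<dots> \<le> b * m\<^sup>2" using b by simp
    finally show ?thesis .
  next
    assume b: "4 \<le> b"
    have "(Suc m)\<^sup>2 \<le> (2 * m)\<^sup>2" using step assms(3) by (intro power_mono) auto
    also have "\<dots> = 4 * m\<^sup>2" by (simp add: power_mult_distrib)
    also have "\<dots> \<le> b * m\<^sup>2" using b by simp
    finally show ?thesis .
  qed
  also have "\<dots> < b * b ^ (m - 1)" using step assms(4) by auto
  also have "\<dots> = b ^ (Suc m - 1)" using step assms(3) by (cases m) auto
  finally show ?case .
qed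

lemma block_value_less:
  assumes "apology_solution F b k m a" and "2 \<le> b" and "i < m"
  shows "block_value b k a i < b ^ k"
  unfolding block_value_def
proof (rule sum_digits_less_power)
  fix j assume "j < k"
  then have "k * i + j < k * Suc i" by simp
  also have "\<dots> \<le> k * m" using assms(3) by (intro mult_le_mono2) simp
  finally show "a ! (k * i + j) \<le> b - 1"
    using assms(1) by (simp add: apology_solution_def)
qed (use assms(2) in simp)

lemma digits_value_le_block_max:
  assumes "apology_solution F b k m a" and "2 \<le> b"
  shows "digits_value b a \<le> m * block_max F b k"
proof -
  have "F (block_value b k a i) \<le> block_max F b k" if "i < m" for i
    using block_value_less[OF assms that] by (auto simp: block_max_def intro!: Max_ge)
  then have "(\<Sum>i<m. F (block_value b k a i)) \<le> (\<Sum>i<m. block_max F b k)"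
    by (intro sum_mono) simp
  then show ?thesis using assms(1) by (simp add: apology_solution_def)
qed

lemma power_le_digits_value:
  assumes "apology_solution F b k m a" and "1 \<le> k"
  shows "b ^ (k * m - 1) \<le> digits_value b a"
proof -
  let ?d = "k * m - 1"
  have a: "a ! ?d \<noteq> 0" "length a = k * m" "1 \<le> m"
    using assms(1) by (simp_all add: apology_solution_def)
  have "b ^ ?d \<le> a ! ?d * b ^ ?d" using a by simp
  \<comment> \<open>\<open>1 \<le> k\<close> and \<open>1 \<le> m\<close> make
    \<open>k * m - 1\<close> a genuine index rather than a truncated difference.\<close>
  also have "\<dots> \<le> (\<Sum>i<length a. a ! i * b ^ i)"
    using a assms(2) by (intro member_le_sum) auto
  finally show ?thesis by (simp add: digits_value_def)
qed

lemma apology_solution_blocks_less: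
  assumes sol: "apology_solution F b k m a" and "2 \<le> b" and "1 \<le> k"
    and growth: "\<And>m. c \<le> m \<Longrightarrow> m\<^sup>2 < b ^ (m - 1)"
  shows "m < max c (block_max F b k)"
proof (rule ccontr)
  assume "\<not> ?thesis"
  then have m: "c \<le> m" "block_max F b k \<le> m" by auto
  \<comment> \<open>Discarding \<open>k\<close> here lets one growth condition serve every block
    length.\<close>
  have "b ^ (m - 1) \<le> b ^ (k * m - 1)"
    using assms(2,3) by (intro power_increasing) (auto intro: diff_le_mono)
  also have "\<dots> \<le> digits_value b a" by (rule power_le_digits_value[OF sol assms(3)])
  also have "\<dots> \<le> m * block_max F b k" by (rule digits_value_le_block_max[OF sol assms(2)])
  also have "\<dots> \<le> m\<^sup>2" using m by (simp add: power2_eq_square)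
  finally show False using growth[OF m(1)] by simp
qed

lemma digits_value_le_power:
  assumes "apology_solution F b k m a" and "2 \<le> b" and "1 \<le> k" and "m < M"
  shows "digits_value b a \<le> b ^ (k * M - 1)"
proof -
  have "digits_value b a < b ^ (k * m)"
    using assms(1,2) sum_digits_less_power[of b "k * m" "(!) a"]
    by (simp add: apology_solution_def digits_value_def)
  \<comment> \<open>Strictness of \<open>m < M\<close> frees a whole block of
    \<open>k \<ge> 1\<close> digits, which pays for the \<open>- 1\<close> in the exponent.\<close>
  moreover have "k * m + k \<le> k * M"
    using mult_le_mono2[of "Suc m" M k] assms(4) by simp
  then have "b ^ (k * m) \<le> b ^ (k * M - 1)"
    using assms(2,3) by (intro power_increasing) auto
  ultimately show ?thesis by simp
qed

text \<open>The threshold 7 for base 2 works for every larger base too, so no case split is needed,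
  and bases 2 to 4 with \<open>k > 1\<close> are covered. Bounding \<open>m\<close> bounds the
  length of the digit lists, whose entries come from a finite set.\<close>

lemma finite_apology_solutions:
  assumes "2 \<le> b" and "1 \<le> k"
  shows "finite {(m, a). apology_solution F b k m a}"
proof (rule finite_subset)
  let ?M = "max 7 (block_max F b k)"
  let ?L = "{a. set a \<subseteq> {..b - 1} \<and> length a \<le> k * ?M}"
  have growth: "m\<^sup>2 < b ^ (m - 1)" if "7 \<le> m" for m
  proof -
    have "m\<^sup>2 < 2 ^ (m - 1)" by (rule square_less_power_pred[OF _ that]) simp_all
    also have "\<dots> \<le> b ^ (m - 1)" using assms(1) by (rule power_mono) simp
    finally show ?thesis .
  qed
  show "{(m, a). apology_solution F b k m a} \<subseteq> {..?M} \<times> ?L"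
  proof (clarify, intro SigmaI CollectI conjI)
    fix m a assume sol: "apology_solution F b k m a"
    have m: "m \<le> ?M"
      using apology_solution_blocks_less[OF sol assms growth] by (rule less_imp_le)
    then show "m \<in> {..?M}" by simp
    show "set a \<subseteq> {..b - 1}"
      using sol by (auto simp: apology_solution_def in_set_conv_nth)
    show "length a \<le> k * ?M"
      using sol mult_le_mono2[OF m] unfolding apology_solution_def by simp
  qed
  show "finite ({..?M} \<times> ?L)"
    by (intro finite_cartesian_product finite_lists_length_le finite_atMost)
qed

theorem theorem2p3:
  fixes F :: "nat \<Rightarrow> nat" and b k :: nat
  assumes "\<And>x. 1 \<le> F x" and "2 \<le> b" and "1 \<le> k"
  shows "finite {(m, a). apology_solution F b k m a} \<and>
    (\<forall>m a. apology_solution F b k m a \<longrightarrow>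
       (k = 1 \<and> b = 2 \<longrightarrow> digits_value b a \<le> b ^ (k * max 7 (block_max F b 1) - 1)) \<and>
       (k = 1 \<and> b = 3 \<longrightarrow> digits_value b a \<le> b ^ (k * max 4 (block_max F b 1) - 1)) \<and>
       (k = 1 \<and> b = 4 \<longrightarrow> digits_value b a \<le> b ^ (k * max 3 (block_max F b 1) - 1)) \<and>
       (5 \<le> b \<longrightarrow> digits_value b a \<le> b ^ (k * max 2 (block_max F b k) - 1)))"
proof (intro conjI allI impI)
  show "finite {(m, a). apology_solution F b k m a}"
    using assms(2,3) by (rule finite_apology_solutions)
next
  fix m a assume sol: "apology_solution F b k m a"
  \<comment> \<open>The base cases are 49 < 64, 16 < 27, 9 < 16 and 4 < 5 \<le> \<open>b\<close>.
    Each \<open>c\<close> is the least possible threshold: at \<open>c - 1\<close> one has 36 > 32,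
    9 = 9, 4 = 4 and 1 = 1.\<close>
  have bound: "digits_value b a \<le> b ^ (k * max c (block_max F b k) - 1)"
    if "c\<^sup>2 < b ^ (c - 1)" "1 \<le> c" "3 \<le> c \<and> 2 \<le> b \<or> 4 \<le> b" for c
    using square_less_power_pred[OF that(1) _ that(2,3)]
    by (intro digits_value_le_power[OF sol assms(2,3)]
        apology_solution_blocks_less[OF sol assms(2,3)])
  show "digits_value b a \<le> b ^ (k * max 7 (block_max F b 1) - 1)" if "k = 1 \<and> b = 2"
    using bound[of 7] that by simp
  show "digits_value b a \<le> b ^ (k * max 4 (block_max F b 1) - 1)" if "k = 1 \<and> b = 3"
    using bound[of 4] that by simp
  show "digits_value b a \<le> b ^ (k * max 3 (block_max F b 1) - 1)" if "k = 1 \<and> b = 4"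
    using bound[of 3] that by simp
  show "digits_value b a \<le> b ^ (k * max 2 (block_max F b k) - 1)" if "5 \<le> b"
    using bound[of 2] that by simp
qed

end
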